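(* Let $L$ be a countable relational language, let $T$ be a countable pithy $\Pi_2$ theory of $\mathcal{L}_{\omega_1,\omega}(L)$, and let $\mathcal{P}$ be a Borel $L$-structure. Suppose $m$ is a continuous probability measure on $\mathbb{R}$ such that $(\mathcal{P},m)$ witnesses $T$. Then $\mu_{(\mathcal{P},m)}$ is concentrated on the set of structures in $S_L$ that are models of $T$.
   Context: $\mathcal{L}_{\omega_1,\omega}(L)$ is the infinitary logic allowing countable conjunctions and disjunctions, finitely many free variables per formula, and finite quantifier strings. A pithy $\Pi_2$ sentence is one of the form $(\forall\mathbf{x})(\exists y)\psi(\mathbf{x},y)$ where $\mathbf{x}y$ is a (possibly with $\mathbf{x}$ empty) tuple of distinct variables, $y$ is a single variable, and $\psi$ is a quantifier-free formula of $\mathcal{L}_{\omega_1,\omega}(L)$; a pithy $\Pi_2$ theory is a set of such sentences. A Borel $L$-structure is an $L$-structure $\mathcal{P}$ with underlying set $\mathbb{R}$ such that for every relation symbol $R$ of arity $j$, $\{\mathbf{a}\in\mathbb{R}^j:\mathcal{P}\models R(\mathbf{a})\}$ is Borel. $S_L$ is the set of $L$-structures with underlying set $\mathbb{N}$ with the Borel $\sigma$-algebra generated by the sets $\{\mathcal{N}: R^{\mathcal{N}}(n_1,\dots,n_j)\}$. For $A=(a_i)_{i\in\omega}\in\mathbb{R}^\omega$, $F_{\mathcal{P}}(A)\in S_L$ is the structure with $F_{\mathcal{P}}(A)\models R(n_1,\dots,n_j)$ iff $\mathcal{P}\models R(a_{n_1},\dots,a_{n_j})$; and $\mu_{(\mathcal{P},m)}:=m^\infty\circ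 F_{\mathcal{P}}^{-1}$, where $m^\infty$ is the product measure on $\mathbb{R}^\omega$. The pair $(\mathcal{P},m)$ witnesses $T$ if for every sentence $(\forall\mathbf{x})(\exists y)\psi(\mathbf{x},y)\in T$ and every tuple $\mathbf{a}$ of reals with $|\mathbf{a}|=|\mathbf{x}|$, either $\mathcal{P}\models\psi(\mathbf{a},b)$ for some entry $b$ of $\mathbf{a}$, or $m(\{b\in\mathbb{R}:\mathcal{P}\models\psi(\mathbf{a},b)\})>0$. A measure on $\mathbb{R}$ is continuous if it gives every singleton measure zero; a measure on $S_L$ is concentrated on a set if it gives it measure $1$. *)

theory Defs
  imports "HOL-Probability.Probability" "HOL-Library.Countable_Set_Type"
begin

section \<open>Infinitary logic over a relational language\<close>

record 'r language =
  rels :: "'r set"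
  arity :: "'r \<Rightarrow> nat"

text \<open>Raw formulas, with variables named by natural numbers.  The conjuncts (disjuncts) of an
  infinitary conjunction (disjunction) form an arbitrary countable set, possibly empty or finite.
  The side conditions on symbols, arities and free variables are imposed by \<open>L_formula\<close>.\<close>

datatype 'r fm =
    Eq nat nat
  | Rel 'r "nat list"
  | Neg "'r fm"
  | Conj "'r fm cset"
  | Disj "'r fm cset"
  | Forall nat "'r fm"
  | Exists nat "'r fm"

primrec fv :: "'r fm \<Rightarrow> nat set" where
  "fv (Eq x y) = {x, y}"
| "fv (Rel R xs) = set xs"
| "fv (Neg \<phi>) = fv \<phi>"
| "fv (Conj \<Phi>) = \<Union> (rcset (cimage fv \<Phi>))"
| "fv (Disj \<Phi>) = \<Union> (rcset (cimage fv \<Phi>))"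
| "fv (Forall x \<phi>) = fv \<phi> - {x}"
| "fv (Exists x \<phi>) = fv \<phi> - {x}"

primrec quantifier_free :: "'r fm \<Rightarrow> bool" where
  "quantifier_free (Eq x y) = True"
| "quantifier_free (Rel R xs) = True"
| "quantifier_free (Neg \<phi>) = quantifier_free \<phi>"
| "quantifier_free (Conj \<Phi>) = (\<forall>b \<in> rcset (cimage quantifier_free \<Phi>). b)"
| "quantifier_free (Disj \<Phi>) = (\<forall>b \<in> rcset (cimage quantifier_free \<Phi>). b)"
| "quantifier_free (Forall x \<phi>) = False"
| "quantifier_free (Exists x \<phi>) = False"

primrec L_formula :: "'r language \<Rightarrow> 'r fm \<Rightarrow> bool" where
  "L_formula L (Eq x y) = True"
| "L_formula L (Rel R xs) = (R \<in> rels L \<and> length xs = arity L R)"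
| "L_formula L (Neg \<phi>) = L_formula L \<phi>"
| "L_formula L (Conj \<Phi>) =
    ((\<forall>b \<in> rcset (cimage (L_formula L) \<Phi>). b) \<and> finite (fv (Conj \<Phi>)))"
| "L_formula L (Disj \<Phi>) =
    ((\<forall>b \<in> rcset (cimage (L_formula L) \<Phi>). b) \<and> finite (fv (Disj \<Phi>)))"
| "L_formula L (Forall x \<phi>) = L_formula L \<phi>"
| "L_formula L (Exists x \<phi>) = L_formula L \<phi>"

text \<open>A structure with underlying set \<open>UNIV :: 'a set\<close> is given by its relations.  Values at
  symbols outside the language, or at tuples of the wrong length, are normalised to \<open>False\<close>,
  so that distinct functions are distinct structures.\<close>

type_synonym ('r, 'a) struct = "'r \<Rightarrow> 'a list \<Rightarrow> bool"

definition L_structure :: "'r language \<Rightarrow> ('r, 'a) struct \<Rightarrow> bool" where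
  "L_structure L M \<longleftrightarrow> (\<forall>R as. M R as \<longrightarrow> R \<in> rels L \<and> length as = arity L R)"

primrec sat :: "('r, 'a) struct \<Rightarrow> 'r fm \<Rightarrow> (nat \<Rightarrow> 'a) \<Rightarrow> bool" where
  "sat M (Eq x y) e = (e x = e y)"
| "sat M (Rel R xs) e = M R (map e xs)"
| "sat M (Neg \<phi>) e = (\<not> sat M \<phi> e)"
| "sat M (Conj \<Phi>) e = (\<forall>p \<in> rcset (cimage (sat M) \<Phi>). p e)"
| "sat M (Disj \<Phi>) e = (\<exists>p \<in> rcset (cimage (sat M) \<Phi>). p e)"
| "sat M (Forall x \<phi>) e = (\<forall>a. sat M \<phi> (e(x := a)))"
| "sat M (Exists x \<phi>) e = (\<exists>a. sat M \<phi> (e(x := a)))"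

text \<open>\<open>sat_at M vs as \<phi>\<close> is \<open>M \<Turnstile> \<phi>(as)\<close>, the tuple \<open>as\<close> being substituted for the
  distinct variables \<open>vs\<close>.  Variables not in \<open>vs\<close> get an irrelevant value: it is only
  used when \<open>fv \<phi> \<subseteq> set vs\<close>.\<close>

definition sat_at :: "('r, 'a) struct \<Rightarrow> nat list \<Rightarrow> 'a list \<Rightarrow> 'r fm \<Rightarrow> bool" where
  "sat_at M vs as \<phi> \<longleftrightarrow> sat M \<phi> (\<lambda>v. the (map_of (zip vs as) v))"

definition models :: "('r, 'a) struct \<Rightarrow> 'r fm set \<Rightarrow> bool" where
  "models M T \<longleftrightarrow> (\<forall>\<phi>\<in>T. \<forall>e. sat M \<phi> e)"

section \<open>Pithy \<open>\<Pi>\<^sub>2\<close> theories\<close>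

definition Pi2 :: "nat list \<Rightarrow> nat \<Rightarrow> 'r fm \<Rightarrow> 'r fm" where
  "Pi2 xs y \<psi> = foldr Forall xs (Exists y \<psi>)"

definition pithy_matrix :: "'r language \<Rightarrow> nat list \<Rightarrow> nat \<Rightarrow> 'r fm \<Rightarrow> bool" where
  "pithy_matrix L xs y \<psi> \<longleftrightarrow>
    distinct (xs @ [y]) \<and> quantifier_free \<psi> \<and> L_formula L \<psi> \<and> fv \<psi> \<subseteq> set (xs @ [y])"

definition pithy_Pi2_theory :: "'r language \<Rightarrow> 'r fm set \<Rightarrow> bool" where
  "pithy_Pi2_theory L T \<longleftrightarrow> (\<forall>\<phi>\<in>T. \<exists>xs y \<psi>. pithy_matrix L xs y \<psi> \<and> \<phi> = Pi2 xs y \<psi>)"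

section \<open>Borel structures and the sampling measure\<close>

definition Borel_structure :: "'r language \<Rightarrow> ('r, real) struct \<Rightarrow> bool" where
  "Borel_structure L P \<longleftrightarrow> L_structure L P \<and>
    (\<forall>R\<in>rels L.
      {a \<in> space (\<Pi>\<^sub>M i\<in>{..<arity L R}. (borel :: real measure)). P R (map a [0..<arity L R])}
        \<in> sets (\<Pi>\<^sub>M i\<in>{..<arity L R}. (borel :: real measure)))"

definition S_L :: "'r language \<Rightarrow> ('r, nat) struct measure" where
  "S_L L = sigma {N. L_structure L N}
    {{N. L_structure L N \<and> N R ns} | R ns. R \<in> rels L \<and> length ns = arity L R}"

definition F_struct :: "('r, real) struct \<Rightarrow> (nat \<Rightarrow> real) \<Rightarrow> ('r, nat) struct" where
  "F_struct P A = (\<lambda>R ns. P R (map A ns))"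

definition mu_struct ::
    "'r language \<Rightarrow> ('r, real) struct \<Rightarrow> real measure \<Rightarrow> ('r, nat) struct measure" where
  "mu_struct L P m = distr (\<Pi>\<^sub>M i\<in>(UNIV :: nat set). m) (S_L L) (F_struct P)"

definition witnesses ::
    "'r language \<Rightarrow> ('r, real) struct \<Rightarrow> real measure \<Rightarrow> 'r fm set \<Rightarrow> bool" where
  "witnesses L P m T \<longleftrightarrow>
    (\<forall>xs y \<psi>. pithy_matrix L xs y \<psi> \<and> Pi2 xs y \<psi> \<in> T \<longrightarrow>
      (\<forall>as. length as = length xs \<longrightarrow>
        (\<exists>b\<in>set as. sat_at P (xs @ [y]) (as @ [b]) \<psi>) \<or>
        emeasure m {b. sat_at P (xs @ [y]) (as @ [b]) \<psi>} > 0))"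

definition continuous_measure :: "real measure \<Rightarrow> bool" where
  "continuous_measure m \<longleftrightarrow> (\<forall>x. emeasure m {x} = 0)"

definition concentrated_on :: "'b measure \<Rightarrow> 'b set \<Rightarrow> bool" where
  "concentrated_on \<mu> E \<longleftrightarrow> E \<in> sets \<mu> \<and> emeasure \<mu> E = 1"

end

theory Submission
  imports Defs
begin

text \<open>A sequence sampled independently from a continuous measure is almost surely injective, so that
  quantifier-free formulas, including those with equality, have the same truth value in the sampled
  structure and in \<open>P\<close>.  As the sampled structure is countable, only countably many
  existential requirements \<open>\<exists>y. \<psi>(ns, y)\<close> have to be met.  Such a requirement
  involves only finitely many coordinates; conditionally on these, either one of them is already a
  witness or the set of witnesses has positive measure and is therefore almost surely hit by the
  independent remaining coordinates.\<close>

section \<open>Satisfaction, environments and the sampled structure\<close>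

lemma sat_cong:
  assumes "\<And>v. v \<in> fv \<phi> \<Longrightarrow> e v = e' v"
  shows "sat M \<phi> e = sat M \<phi> e'"
  using assms
proof (induction \<phi> arbitrary: e e')
  case (Rel R vs)
  then have "map e vs = map e' vs" by simp
  then show ?case by (simp only: sat.simps)
next
  case (Neg \<phi>)
  then show ?case by (metis fv.simps(3) sat.simps(3))
next
  case (Conj \<Phi>)
  have "sat M \<phi> e = sat M \<phi> e'" if "\<phi> \<in> rcset \<Phi>" for \<phi>
    using Conj.prems that by (intro Conj.IH[OF that]) (auto simp: cimage.rep_eq)
  then show ?case by (simp add: cimage.rep_eq)
next
  case (Disj \<Phi>)
  have "sat M \<phi> e = sat M \<phi> e'" if "\<phi> \<in> rcset \<Phi>" for \<phi>
    using Disj.prems that by (intro Disj.IH[OF that]) (auto simp: cimage.rep_eq)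
  then show ?case by (simp add: cimage.rep_eq)
next
  case (Forall x \<phi>)
  have "sat M \<phi> (e(x := a)) = sat M \<phi> (e'(x := a))" for a
    using Forall.prems by (intro Forall.IH) auto
  then show ?case by simp
next
  case (Exists x \<phi>)
  have "sat M \<phi> (e(x := a)) = sat M \<phi> (e'(x := a))" for a
    using Exists.prems by (intro Exists.IH) auto
  then show ?case by simp
qed simp

text \<open>Bridges the tuples in \<open>witnesses\<close> and environments: as \<open>y\<close> is
  not in \<open>xs\<close>, updating \<open>e\<close> at \<open>y\<close> keeps the values on
  \<open>xs\<close>.\<close>

lemma sat_at_eq_sat:
  assumes "fv \<psi> \<subseteq> set (xs @ [y])" "distinct (xs @ [y])"
  shows "sat_at M (xs @ [y]) (map e xs @ [b]) \<psi> \<longleftrightarrow> sat M \<psi> (e(y := b))"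
  unfolding sat_at_def
proof (rule sat_cong)
  fix v assume "v \<in> fv \<psi>"
  then have v: "v \<in> set (xs @ [y])" using assms by auto
  have "map e xs @ [b] = map (e(y := b)) (xs @ [y])" using assms(2) by auto
  then show "the (map_of (zip (xs @ [y]) (map e xs @ [b])) v) = (e(y := b)) v"
    using v by (simp only: map_of_zip_map) simp
qed

text \<open>Relation atoms transfer by the definition of \<open>F_struct\<close>, equality atoms by
  injectivity. Quantifiers would range over indices on one side and over all reals on the
  other.\<close>

lemma sat_F_struct:
  assumes "inj A" "quantifier_free \<psi>"
  shows "sat (F_struct P A) \<psi> e \<longleftrightarrow> sat P \<psi> (A \<circ> e)"
  using assms(2)
  by (induction \<psi>) (simp_all add: cimage.rep_eq F_struct_def inj_eq[OF assms(1)])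

lemma all_sat_foldr_Forall:
  "(\<forall>e. sat M (foldr Forall xs \<phi>) e) \<longleftrightarrow> (\<forall>e. sat M \<phi> e)"
proof (induction xs)
  case (Cons x xs)
  have "(\<forall>e a. sat M \<theta> (e(x := a))) \<longleftrightarrow> (\<forall>e. sat M \<theta> e)" for \<theta>
    by (metis fun_upd_triv)
  with Cons show ?case by simp
qed simp

text \<open>Lists of naturals form a countable type, so quantifying over them stays within countable
  set operations.\<close>

definition env :: "nat list \<Rightarrow> nat \<Rightarrow> nat" where
  "env ns v = (if v < length ns then ns ! v else 0)"

text \<open>Environments range over an uncountable type; it suffices to consider those given by lists.\<close>

lemma all_sat_Pi2_iff:
  assumes "fv \<psi> \<subseteq> set (xs @ [y])"
  shows "(\<forall>e. sat N (Pi2 xs y \<psi>) e) \<longleftrightarrow> (\<forall>ns. \<exists>k. sat N \<psi> ((env ns)(y := k)))"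
proof -
  have "\<exists>k. sat N \<psi> (e(y := k))" if all: "\<forall>ns. \<exists>k. sat N \<psi> ((env ns)(y := k))" for e
  proof -
    \<comment> \<open>With \<open>n\<close> above all variables, the list of the first
      \<open>n\<close> values of \<open>e\<close> agrees with \<open>e\<close> on the free
      variables.\<close>
    obtain n where n: "\<And>v. v \<in> set (xs @ [y]) \<Longrightarrow> v < n"
      using finite_nat_set_iff_bounded[of "set (xs @ [y])"] by auto
    obtain k where "sat N \<psi> ((env (map e [0..<n]))(y := k))" using all by blast
    also have "sat N \<psi> ((env (map e [0..<n]))(y := k)) = sat N \<psi> (e(y := k))"
      using assms n by (intro sat_cong) (auto simp: env_def)
    finally show ?thesis by blast
  qed
  then show ?thesis by (auto simp: Pi2_def all_sat_foldr_Forall)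
qed

section \<open>Measurability in \<open>S_L\<close> and in Borel structures\<close>

lemma space_S_L: "space (S_L L) = {N. L_structure L N}"
  unfolding S_L_def by (rule space_measure_of) auto

lemma sets_S_L_rel:
  assumes "R \<in> rels L" "length ns = arity L R"
  shows "{N \<in> space (S_L L). N R ns} \<in> sets (S_L L)"
proof -
  have "{N. L_structure L N \<and> N R ns} \<in> sets (S_L L)"
    unfolding S_L_def using assms by (intro in_measure_of) auto
  then show ?thesis by (simp add: space_S_L)
qed

text \<open>For fixed \<open>e\<close>, equality atoms do not depend on \<open>N\<close>, relation
  atoms give generators, and countable connectives are sigma-algebra operations.\<close>

lemma sets_S_L_sat:
  assumes "quantifier_free \<psi>" "L_formula L \<psi>"
  shows "{N \<in> space (S_L L). sat N \<psi> e} \<in> sets (S_L L)"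
  using assms
proof (induction \<psi>)
  case (Rel R xs)
  then show ?case using sets_S_L_rel[of R L "map e xs"] by simp
next
  case (Neg \<psi>)
  then show ?case by (simp add: sets.sets_Collect_neg)
next
  case (Conj \<Phi>)
  then show ?case
    by (simp add: cimage.rep_eq sets.sets_Collect_countable_All')
next
  case (Disj \<Phi>)
  then show ?case
    by (simp add: cimage.rep_eq sets.sets_Collect_countable_Ex')
qed simp_all

text \<open>Each sentence becomes a countable intersection over lists of countable unions over
  witnesses \<open>k\<close>.\<close>

lemma sets_models:
  assumes "countable T" "pithy_Pi2_theory L T"
  shows "{N \<in> space (S_L L). models N T} \<in> sets (S_L L)"
  unfolding models_def
proof (rule sets.sets_Collect_countable_All'[OF _ assms(1)])
  fix \<phi> assume "\<phi> \<in> T"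
  then obtain xs y \<psi> where \<phi>: "pithy_matrix L xs y \<psi>" "\<phi> = Pi2 xs y \<psi>"
    using assms(2) unfolding pithy_Pi2_theory_def by blast
  then have \<psi>: "quantifier_free \<psi>" "L_formula L \<psi>" "fv \<psi> \<subseteq> set (xs @ [y])"
    by (simp_all add: pithy_matrix_def)
  show "{N \<in> space (S_L L). \<forall>e. sat N \<phi> e} \<in> sets (S_L L)"
    unfolding \<phi>(2) all_sat_Pi2_iff[OF \<psi>(3)]
    by (rule sets.sets_Collect_countable_All, rule sets.sets_Collect_countable_Ex)
      (rule sets_S_L_sat[OF \<psi>(1,2)])
qed

lemma sets_Borel_structure_rel:
  fixes P :: "('r, real) struct"
  assumes "Borel_structure L P" "R \<in> rels L" "length xs = arity L R"
    and [measurable]: "\<And>v. (\<lambda>x. f x v) \<in> borel_measurable M"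
  shows "{x \<in> space M. P R (map (f x) xs)} \<in> sets M"
proof -
  let ?n = "arity L R"
  let ?B = "\<Pi>\<^sub>M i\<in>{..<?n}. (borel :: real measure)"
  \<comment> \<open>The tuple read off by \<open>xs\<close>, as a point of the product space used in
    \<open>Borel_structure\<close>.\<close>
  let ?g = "\<lambda>x. \<lambda>i\<in>{..<?n}. f x (xs ! i)"
  have g: "?g \<in> measurable M ?B" by measurable
  have "map (?g x) [0..<?n] = map (f x) xs" for x
    using assms(3) by (intro nth_equalityI) auto
  then have "{x \<in> space M. P R (map (f x) xs)}
      = ?g -` {a \<in> space ?B. P R (map a [0..<?n])} \<inter> space M"
    using measurable_space[OF g] by auto
  also have "\<dots> \<in> sets M"
    using assms(1,2) by (intro measurable_sets[OF g]) (auto simp: Borel_structure_def)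
  finally show ?thesis .
qed

text \<open>The measurable family \<open>f\<close> of environments covers both a random sequence and
  a single varying real.\<close>

lemma sets_Borel_structure_sat:
  fixes P :: "('r, real) struct"
  assumes "Borel_structure L P" "quantifier_free \<psi>" "L_formula L \<psi>"
    and [measurable]: "\<And>v. (\<lambda>x. f x v) \<in> borel_measurable M"
  shows "{x \<in> space M. sat P \<psi> (f x)} \<in> sets M"
  using assms(2,3)
proof (induction \<psi>)
  case (Eq x y)
  show ?case by simp
next
  case (Rel R xs)
  then show ?case by (simp add: sets_Borel_structure_rel[OF assms(1)])
next
  case (Neg \<psi>)
  then show ?case by (simp add: sets.sets_Collect_neg)
next
  case (Conj \<Phi>)
  then show ?case
    by (simp add: cimage.rep_eq sets.sets_Collect_countable_All')
next
  case (Disj \<Phi>)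
  then show ?case
    by (simp add: cimage.rep_eq sets.sets_Collect_countable_Ex')
qed simp_all

lemma borel_measurable_component:
  fixes m :: "real measure"
  assumes "sets m = sets borel"
  shows "(\<lambda>A. A i) \<in> borel_measurable (\<Pi>\<^sub>M i\<in>(UNIV :: nat set). m)"
  using measurable_component_singleton[OF UNIV_I, of i "\<lambda>_. m"]
  by (simp only: measurable_cong_sets[OF refl assms])

text \<open>It suffices to check generators of \<open>S_L L\<close>, whose preimages are Borel
  conditions on finitely many coordinates.\<close>

lemma measurable_F_struct:
  fixes P :: "('r, real) struct"
  assumes P: "Borel_structure L P" and m: "sets m = sets borel"
  shows "F_struct P \<in> measurable (\<Pi>\<^sub>M i\<in>(UNIV :: nat set). m) (S_L L)"
  unfolding S_L_def
proof (rule measurable_measure_of)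
  show "F_struct P \<in> space (\<Pi>\<^sub>M i\<in>UNIV. m) \<rightarrow> {N. L_structure L N}"
    using P by (fastforce simp: F_struct_def L_structure_def Borel_structure_def)
  fix X :: "('r, nat) struct set"
  assume "X \<in> {{N. L_structure L N \<and> N R ns} | R ns. R \<in> rels L \<and> length ns = arity L R}"
  then obtain R ns where X: "X = {N. L_structure L N \<and> N R ns}" "R \<in> rels L" "length ns = arity L R"
    by blast
  have "F_struct P -` X \<inter> space (\<Pi>\<^sub>M i\<in>UNIV. m) = {A \<in> space (\<Pi>\<^sub>M i\<in>UNIV. m). P R (map A ns)}"
    using P by (fastforce simp: X F_struct_def L_structure_def Borel_structure_def)
  also have "\<dots> \<in> sets (\<Pi>\<^sub>M i\<in>UNIV. m)"
    by (intro sets_Borel_structure_rel[OF P X(2,3)] borel_measurable_component m)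
  finally show "F_struct P -` X \<inter> space (\<Pi>\<^sub>M i\<in>UNIV. m) \<in> sets (\<Pi>\<^sub>M i\<in>UNIV. m)" .
qed auto

section \<open>Almost sure properties of independent samples\<close>

context sequence_space
begin

text \<open>The first \<open>n\<close> entries of \<open>\<omega>\<close> followed by an independent
  \<open>\<omega>'\<close> again have law \<open>S\<close>, so by Fubini the first \<open>n\<close>
  coordinates may be held fixed.\<close>

lemma AE_split_sequence:
  assumes [measurable]: "Measurable.pred S Q"
    and "\<And>\<omega>. \<omega> \<in> space S \<Longrightarrow> AE \<omega>' in S. Q (comb_seq n \<omega> \<omega>')"
  shows "AE A in S. Q A"
proof -
  interpret SS: pair_sigma_finite S S ..
  have "AE p in S \<Otimes>\<^sub>M S. Q (comb_seq n (fst p) (snd p))"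
    using assms(2) by (intro SS.AE_pair_measure) auto
  then have "AE A in distr (S \<Otimes>\<^sub>M S) S (\<lambda>(\<omega>, \<omega>'). comb_seq n \<omega> \<omega>'). Q A"
    by (subst AE_distr_iff) (auto simp: case_prod_beta)
  then show ?thesis by (simp only: PiM_comb_seq)
qed

text \<open>Each independent entry misses \<open>B\<close> with the same probability below 1, so all
  of them miss it with probability 0.\<close>

lemma AE_hits_positive_set:
  assumes B: "B \<in> sets M" "emeasure M B > 0"
  shows "AE A in S. \<exists>k. A k \<in> B"
proof -
  let ?C = "space M - B"
  have C: "?C \<in> sets M" using B by auto
  have "measure M B > 0" using B by (simp add: M.emeasure_eq_measure)
  then have "measure M ?C < 1" using B by (simp add: M.prob_compl)
  \<comment> \<open>The product over \<open>i \<le> n\<close> has \<open>n + 1\<close> factors;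
    splitting one off leaves the \<open>n\<close>-th power.\<close>
  then have "(\<lambda>n. measure M ?C * measure M ?C ^ n) \<longlonglongrightarrow> measure M ?C * 0"
    by (intro tendsto_intros LIMSEQ_power_zero) auto
  moreover have "(\<lambda>n. \<Prod>i\<le>n. measure M ?C) \<longlonglongrightarrow> measure S (Pi UNIV (\<lambda>_. ?C))"
    using C by (rule measure_PiM_countable)
  ultimately have "measure S (Pi UNIV (\<lambda>_. ?C)) = measure M ?C * 0"
    by (intro LIMSEQ_unique) (simp_all add: lessThan_Suc_atMost[symmetric])
  moreover have "Pi UNIV (\<lambda>_. ?C) \<in> sets S"
    using C by (rule infprod_in_sets)
  ultimately have "Pi UNIV (\<lambda>_. ?C) \<in> null_sets S"
    by (simp add: emeasure_eq_measure null_sets_def)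
  then show ?thesis
    by (rule AE_I') (auto simp: space_PiM PiE_UNIV_domain)
qed

end

text \<open>There are countably many pairs of indices; in each, the later entry is a fresh sample,
  which by continuity almost surely avoids the earlier value.\<close>

lemma AE_inj_sequence:
  fixes m :: "real measure"
  assumes "prob_space m" "sets m = sets borel" "continuous_measure m"
  shows "AE A in (\<Pi>\<^sub>M i\<in>(UNIV :: nat set). m). inj A"
proof -
  interpret m: prob_space m by fact
  interpret sequence_space m ..
  have "AE A in S. A i \<noteq> A j" if "i < j" for i j
  \<comment> \<open>Splitting at \<open>j\<close> fixes entry \<open>i\<close> and makes entry
    \<open>j\<close> the entry 0 of the fresh sequence.\<close>
  proof (rule AE_split_sequence[where n = j])
    fix \<omega>
    have "{\<omega> i} \<in> null_sets m"
      using assms by (auto simp: continuous_measure_def null_sets_def)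
    then have "AE x in m. x \<noteq> \<omega> i" using AE_not_in by force
    then have "AE \<omega>' in S. \<omega>' 0 \<noteq> \<omega> i" by (rule AE_component[rotated]) simp
    then show "AE \<omega>' in S. comb_seq j \<omega> \<omega>' i \<noteq> comb_seq j \<omega> \<omega>' j"
      by eventually_elim (use that in \<open>simp add: comb_seq_def\<close>)
  qed (auto simp: pred_def intro!: borel_measurable_neq borel_measurable_component assms(2))
  then have "AE A in S. \<forall>i j. i < j \<longrightarrow> A i \<noteq> A j"
    by (simp add: AE_all_countable)
  then show ?thesis by eventually_elim (auto intro: linorder_injI)
qed

section \<open>Existential witnesses and concentration on the models\<close>

lemma AE_sat_witness:
  fixes P :: "('r, real) struct"
  assumes "Borel_structure L P" "prob_space m" "sets m = sets borel" "witnesses L P m T"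
    and "pithy_matrix L xs y \<psi>" "Pi2 xs y \<psi> \<in> T"
  shows "AE A in (\<Pi>\<^sub>M i\<in>(UNIV :: nat set). m). \<exists>k. sat P \<psi> (A \<circ> e(y := k))"
proof -
  interpret m: prob_space m by fact
  interpret sequence_space m ..
  have space_m: "space m = UNIV" using sets_eq_imp_space_eq[OF assms(3)] by simp
  have \<psi>: "quantifier_free \<psi>" "L_formula L \<psi>" "fv \<psi> \<subseteq> set (xs @ [y])" "distinct (xs @ [y])"
    using assms(5) by (auto simp: pithy_matrix_def)
  \<comment> \<open>All indices of parameters lie below \<open>n\<close>, hence in the block to be
    fixed.\<close>
  obtain n where n: "\<And>x. x \<in> set xs \<Longrightarrow> e x < n"
    using finite_nat_set_iff_bounded[of "e ` set xs"] by auto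
  show ?thesis
  proof (rule AE_split_sequence[where n = n])
    show "Measurable.pred S (\<lambda>A. \<exists>k. sat P \<psi> (A \<circ> e(y := k)))"
      unfolding pred_def
      by (intro sets.sets_Collect_countable_Ex sets_Borel_structure_sat[OF assms(1) \<psi>(1,2)])
        (simp add: borel_measurable_component[OF assms(3)])
    fix \<omega> assume "\<omega> \<in> space S"
    define as where "as = map (\<omega> \<circ> e) xs"
    let ?B = "{b. sat P \<psi> ((\<omega> \<circ> e)(y := b))}"
    \<comment> \<open>The parameters are read from \<open>\<omega>\<close>, so only the value at
      \<open>y\<close> can depend on \<open>\<omega>'\<close>, and \<open>?B\<close> is a fixed
      set.\<close>
    have sat_comb: "sat P \<psi> (comb_seq n \<omega> \<omega>' \<circ> e(y := k))
        \<longleftrightarrow> sat P \<psi> ((\<omega> \<circ> e)(y := comb_seq n \<omega> \<omega>' k))" for \<omega>' k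
      using \<psi>(3) n by (intro sat_cong) (auto simp: comb_seq_def)
    have "(\<exists>b\<in>set as. b \<in> ?B) \<or> emeasure m ?B > 0"
      using assms(4)[unfolded witnesses_def, rule_format, of xs y \<psi> as] assms(5,6)
      by (simp add: as_def sat_at_eq_sat[OF \<psi>(3,4)])
    then show "AE \<omega>' in S. \<exists>k. sat P \<psi> (comb_seq n \<omega> \<omega>' \<circ> e(y := k))"
    proof
      assume "\<exists>b\<in>set as. b \<in> ?B"
      then obtain x where "x \<in> set xs" "sat P \<psi> ((\<omega> \<circ> e)(y := \<omega> (e x)))"
        by (auto simp: as_def)
      \<comment> \<open>The witness is already a parameter, so its index \<open>e x\<close> serves
        for every \<open>\<omega>'\<close>.\<close>
      then have "sat P \<psi> (comb_seq n \<omega> \<omega>' \<circ> e(y := e x))" for \<omega>'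
        unfolding sat_comb using n by (simp add: comb_seq_def)
      then show ?thesis by blast
    next
      assume pos: "emeasure m ?B > 0"
      \<comment> \<open>As \<open>b\<close> varies, each coordinate of the environment is constant
        or \<open>b\<close> itself.\<close>
      have "{b \<in> space m. sat P \<psi> ((\<omega> \<circ> e)(y := b))} \<in> sets m"
        by (rule sets_Borel_structure_sat[OF assms(1) \<psi>(1,2)])
          (simp add: measurable_cong_sets[OF assms(3) refl])
      then have "?B \<in> sets m" by (simp add: space_m)
      from AE_hits_positive_set[OF this pos] show ?thesis
      proof eventually_elim
        case (elim \<omega>')
        then obtain k where "sat P \<psi> ((\<omega> \<circ> e)(y := \<omega>' k))" by auto
        \<comment> \<open>Entry \<open>k\<close> of the fresh sequence has index
          \<open>n + k\<close> in the combined one.\<close>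
        then have "sat P \<psi> (comb_seq n \<omega> \<omega>' \<circ> e(y := n + k))"
          unfolding sat_comb by (simp add: comb_seq_def)
        then show ?case by blast
      qed
    qed
  qed
qed

theorem theorem3p10:
  fixes L :: "'r language"
    and T :: "'r fm set"
    and P :: "('r, real) struct"
    and m :: "real measure"
  assumes "countable (rels L)"
    and "pithy_Pi2_theory L T"
    and "countable T"
    and "Borel_structure L P"
    and "prob_space m"
    and "sets m = sets borel"
    and "continuous_measure m"
    and "witnesses L P m T"
  shows "concentrated_on (mu_struct L P m) {N \<in> space (S_L L). models N T}"
proof -
  interpret m: prob_space m by fact
  interpret sequence_space m ..
  note F = measurable_F_struct[OF assms(4,6)]
  have "AE A in S. \<forall>ns. \<exists>k. sat (F_struct P A) \<psi> ((env ns)(y := k))"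
    if "pithy_matrix L xs y \<psi>" "Pi2 xs y \<psi> \<in> T" for xs y \<psi>
    unfolding AE_all_countable
  proof
    fix ns
    have qf: "quantifier_free \<psi>" using that by (simp add: pithy_matrix_def)
    \<comment> \<open>For an injective sample, an index that works in \<open>P\<close> also works in
      the sampled structure.\<close>
    from AE_inj_sequence[OF assms(5-7)] AE_sat_witness[OF assms(4-6,8) that, of "env ns"]
    show "AE A in S. \<exists>k. sat (F_struct P A) \<psi> ((env ns)(y := k))"
      by eventually_elim (simp add: sat_F_struct qf)
  qed
  then have *: "AE A in S. \<forall>e. sat (F_struct P A) (Pi2 xs y \<psi>) e"
    if "pithy_matrix L xs y \<psi>" "Pi2 xs y \<psi> \<in> T" for xs y \<psi>
    using that by (simp add: all_sat_Pi2_iff pithy_matrix_def)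
  then have "AE A in S. \<forall>e. sat (F_struct P A) \<phi> e" if "\<phi> \<in> T" for \<phi>
  proof -
    obtain xs y \<psi> where "pithy_matrix L xs y \<psi>" "\<phi> = Pi2 xs y \<psi>"
      using assms(2) \<open>\<phi> \<in> T\<close> unfolding pithy_Pi2_theory_def by blast
    with * \<open>\<phi> \<in> T\<close> show ?thesis by simp
  qed
  \<comment> \<open>The exceptional null sets of countably many sentences have a null union.\<close>
  then have "AE A in S. models (F_struct P A) T"
    unfolding models_def by (simp add: AE_ball_countable assms(3))
  moreover have "F_struct P A \<in> space (S_L L)" if "A \<in> space S" for A
    using measurable_space[OF F that] .
  ultimately have "emeasure S (F_struct P -` {N \<in> space (S_L L). models N T} \<inter> space S) = 1"
    by (intro emeasure_eq_1_AE measurable_sets[OF F] sets_models assms) auto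
  then show ?thesis
    using sets_models[OF assms(3,2)]
    by (simp add: concentrated_on_def mu_struct_def emeasure_distr[OF F])
qed

end
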